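(* Let $\Gamma_1$ and $\Gamma_2$ be simple digraphs. Then $\operatorname{th}(\Gamma_1\cup\Gamma_2)=\operatorname{th}(\Gamma_1^T\cup\Gamma_2)$, where $\cup$ denotes disjoint union.
   Context: A simple digraph has a finite vertex set and no loops or parallel arcs (opposite arcs allowed). The transpose $\Gamma^T$ is obtained by reversing every arc of $\Gamma$. $v$ is an out-neighbor of $u$ if $(u,v)$ is an arc. Zero forcing: vertices are blue or white; a blue vertex $u$ with exactly one white out-neighbor $w$ may force $w$ ($u\to w$), turning it blue. A set $\mathcal F$ of forces is a set of forces of $B\subseteq V(\Gamma)$ if, starting with exactly $B$ blue, the forces in $\mathcal F$ can be validly performed in some order after which no further force is possible. Put $\mathcal F^{[0]}=B$ and $\mathcal F^{[t+1]}=\mathcal F^{[t]}\cup\{w\notin\mathcal F^{[t]}:(u\to w)\in\mathcal F,\ u\in\mathcal F^{[t]},\ w$ the only out-neighbor of $u$ outside $\mathcal F^{[t]}\}$; $\operatorname{pt}(\Gamma;\mathcal F)$ is the least $t$ with $\mathcal F^{[t]}=V(\Gamma)$ ($\infty$ if none); $\operatorname{pt}(\Gamma;B)=\min_{\mathcal F}\operatorname{pt}(\Gamma;\mathcal F)$. The throttling number is $\operatorname{th}(\Gamma)=\min_{B\subseteq V(\Gamma)}(|B|+\operatorname{pt}(\Gamma;B))$. *)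

theory Defs
  imports "Graph_Theory.Pair_Digraph" "HOL-Library.Extended_Nat"
begin

text \<open>
  A simple digraph is a \<^locale>\<open>pair_digraph\<close>: finite, loopless, and without parallel arcs
  because its arcs form a set of ordered pairs.
\<close>

definition transpose_digraph :: "'a pair_pre_digraph \<Rightarrow> 'a pair_pre_digraph" where
  "transpose_digraph G = \<lparr> pverts = pverts G, parcs = (parcs G)\<inverse> \<rparr>"

definition disjoint_union ::
    "'a pair_pre_digraph \<Rightarrow> 'b pair_pre_digraph \<Rightarrow> ('a + 'b) pair_pre_digraph" where
  "disjoint_union G H =
    \<lparr> pverts = pverts G <+> pverts H,
      parcs = map_prod Inl Inl ` parcs G \<union> map_prod Inr Inr ` parcs H \<rparr>"

definition out_neighbors :: "'a pair_pre_digraph \<Rightarrow> 'a \<Rightarrow> 'a set" where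
  "out_neighbors G u = {v. (u, v) \<in> parcs G}"

text \<open>In \<open>can_force G S u w\<close> the set \<open>S\<close> consists of the blue vertices.\<close>

definition can_force :: "'a pair_pre_digraph \<Rightarrow> 'a set \<Rightarrow> 'a \<Rightarrow> 'a \<Rightarrow> bool" where
  "can_force G S u w \<longleftrightarrow> u \<in> S \<and> out_neighbors G u - S = {w}"

text \<open>
  \<open>forcing_run G S fs S'\<close>: performing the forces of the list \<open>fs\<close> one after another, each of them
  valid at its turn, turns the blue set \<open>S\<close> into the blue set \<open>S'\<close>.  The pair \<open>(u, w)\<close> stands
  for the force \<open>u \<rightarrow> w\<close>.
\<close>

inductive forcing_run ::
    "'a pair_pre_digraph \<Rightarrow> 'a set \<Rightarrow> ('a \<times> 'a) list \<Rightarrow> 'a set \<Rightarrow> bool"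
  for G where
  forcing_run_Nil: "forcing_run G S [] S"
| forcing_run_Cons: "can_force G S u w \<Longrightarrow> forcing_run G (insert w S) fs S' \<Longrightarrow>
    forcing_run G S ((u, w) # fs) S'"

definition is_set_of_forces :: "'a pair_pre_digraph \<Rightarrow> 'a set \<Rightarrow> ('a \<times> 'a) set \<Rightarrow> bool" where
  "is_set_of_forces G B F \<longleftrightarrow>
    (\<exists>fs S. set fs = F \<and> forcing_run G B fs S \<and> (\<nexists>u w. can_force G S u w))"

primrec blue_at :: "'a pair_pre_digraph \<Rightarrow> 'a set \<Rightarrow> ('a \<times> 'a) set \<Rightarrow> nat \<Rightarrow> 'a set" where
  "blue_at G B F 0 = B"
| "blue_at G B F (Suc t) =
    blue_at G B F t \<union>
    {w. w \<notin> blue_at G B F t \<and> (\<exists>u. (u, w) \<in> F \<and> can_force G (blue_at G B F t) u w)}"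

definition prop_time_forces ::
    "'a pair_pre_digraph \<Rightarrow> 'a set \<Rightarrow> ('a \<times> 'a) set \<Rightarrow> enat" where
  "prop_time_forces G B F =
    (if \<exists>t. blue_at G B F t = pverts G
     then enat (LEAST t. blue_at G B F t = pverts G) else \<infinity>)"

text \<open>
  The infima below are minima: \<^typ>\<open>enat\<close> is well-ordered, and the index sets are nonempty
  (for the first one see \<open>ex_set_of_forces\<close>).
\<close>

definition prop_time :: "'a pair_pre_digraph \<Rightarrow> 'a set \<Rightarrow> enat" where
  "prop_time G B = (INF F\<in>{F. is_set_of_forces G B F}. prop_time_forces G B F)"

definition throttling_number :: "'a pair_pre_digraph \<Rightarrow> enat" where
  "throttling_number G = (INF B\<in>Pow (pverts G). enat (card B) + prop_time G B)"

lemma pair_digraph_transpose: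
  assumes "pair_digraph G"
  shows "pair_digraph (transpose_digraph G)"
proof -
  interpret pair_digraph G by fact
  show ?thesis
    using pair_finite_verts pair_finite_arcs
    by unfold_locales (auto simp: transpose_digraph_def dest: in_arcsD1 in_arcsD2 pair_no_loops)
qed

lemma pair_digraph_disjoint_union:
  assumes "pair_digraph G" "pair_digraph H"
  shows "pair_digraph (disjoint_union G H)"
proof -
  interpret G: pair_digraph G by fact
  interpret H: pair_digraph H by fact
  show ?thesis
    using G.pair_finite_verts G.pair_finite_arcs H.pair_finite_verts H.pair_finite_arcs
    by unfold_locales
      (auto simp: disjoint_union_def dest: G.in_arcsD1 G.in_arcsD2 G.pair_no_loops
        H.in_arcsD1 H.in_arcsD2 H.pair_no_loops)
qed

lemma ex_set_of_forces:
  assumes "pair_digraph G" "B \<subseteq> pverts G"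
  shows "\<exists>F. is_set_of_forces G B F"
proof -
  interpret pair_digraph G by fact
  have "\<exists>fs S'. forcing_run G S fs S' \<and> (\<nexists>u w. can_force G S' u w)"
    if "S \<subseteq> pverts G" for S
    using that
  proof (induction "card (pverts G - S)" arbitrary: S rule: less_induct)
    case less
    show ?case
    proof (cases "\<exists>u w. can_force G S u w")
      case False
      then show ?thesis using forcing_run_Nil by blast
    next
      case True
      then obtain u w where uw: "can_force G S u w" by blast
      then have w: "w \<in> pverts G" "w \<notin> S"
        by (auto simp: can_force_def out_neighbors_def dest: in_arcsD2)
      then have "card (pverts G - insert w S) < card (pverts G - S)"
        by (intro psubset_card_mono) (auto simp: pair_finite_verts)
      moreover have "insert w S \<subseteq> pverts G" using w less.prems by simp
      ultimately obtain fs S' where run: "forcing_run G (insert w S) fs S'"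
        and stop: "\<nexists>u w. can_force G S' u w"
        using less.hyps by blast
      have "forcing_run G S ((u, w) # fs) S'" using uw run by (rule forcing_run_Cons)
      then show ?thesis using stop by (intro exI[of _ "(u, w) # fs"] exI[of _ S'] conjI)
    qed
  qed
  from this[OF assms(2)] obtain fs S where
    "forcing_run G B fs S" "\<nexists>u w. can_force G S u w"
    by (elim exE conjE)
  then have "is_set_of_forces G B (set fs)"
    unfolding is_set_of_forces_def by (intro exI[of _ fs] exI[of _ S] conjI refl)
  then show ?thesis by (rule exI)
qed

lemma throttling_number_le_card:
  assumes "pair_digraph G"
  shows "throttling_number G \<le> enat (card (pverts G))"
proof -
  obtain F where F: "is_set_of_forces G (pverts G) F"
    using ex_set_of_forces[OF assms] by blast
  have 0: "blue_at G (pverts G) F 0 = pverts G" by simp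
  then have "(LEAST t. blue_at G (pverts G) F t = pverts G) = 0"
    by (rule Least_eq_0)
  moreover have "\<exists>t. blue_at G (pverts G) F t = pverts G"
    using 0 by (rule exI)
  ultimately have "prop_time_forces G (pverts G) F = 0"
    unfolding prop_time_forces_def zero_enat_def by presburger
  then have "prop_time G (pverts G) \<le> 0"
    unfolding prop_time_def using F by (intro INF_lower2[of F]) auto
  then show ?thesis
    unfolding throttling_number_def by (intro INF_lower2[of "pverts G"]) auto
qed

end

theory Submission
  imports Defs
begin

text \<open>
  A propagation process reaching all vertices by time \<open>t\<close> is encoded by the time \<open>f v\<close> at
  which each vertex turns blue and a forcer \<open>p w\<close> of every initially white vertex \<open>w\<close>.
  No vertex forces twice.  Running the process backwards, with all forces reversed and the force
  \<open>u \<rightarrow> w\<close> performed at time \<open>t + 1 - f w\<close>, is a process on the transpose.  It starts from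
  the vertices that perform no force, and there are as many of these as initially blue vertices.
  Processes on a disjoint union are pairs of processes on the parts with the same time bound, so
  one part may be reversed independently of the other.
\<close>

section \<open>Schedules of forces\<close>

text \<open>Only inequalities between times are required, so a force may be performed later than it
  first becomes possible. This slack matters: a reversed process need not force as early as
  possible, and a part of a union may finish before \<open>t\<close>.\<close>

definition forcing_schedule ::
    "'a pair_pre_digraph \<Rightarrow> nat \<Rightarrow> ('a \<Rightarrow> nat) \<Rightarrow> ('a \<Rightarrow> 'a) \<Rightarrow> bool" where
  "forcing_schedule G t f p \<longleftrightarrow>
    (\<forall>w\<in>pverts G. f w \<le> t \<and>
      (0 < f w \<longrightarrow> (p w, w) \<in> parcs G \<and> f (p w) < f w \<and>
        (\<forall>x. (p w, x) \<in> parcs G \<and> x \<noteq> w \<longrightarrow> f x < f w)))"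

text \<open>\<open>k\<close> and \<open>t\<close> are kept apart because a disjoint union adds the
  former and shares the latter.\<close>

definition schedulable :: "'a pair_pre_digraph \<Rightarrow> nat \<Rightarrow> nat \<Rightarrow> bool" where
  "schedulable G k t \<longleftrightarrow>
    (\<exists>f p. forcing_schedule G t f p \<and> card {v \<in> pverts G. f v = 0} = k)"

lemma forcing_scheduleI:
  assumes "\<And>w. w \<in> pverts G \<Longrightarrow> f w \<le> t"
    and "\<And>w. w \<in> pverts G \<Longrightarrow> 0 < f w \<Longrightarrow> (p w, w) \<in> parcs G"
    and "\<And>w. w \<in> pverts G \<Longrightarrow> 0 < f w \<Longrightarrow> f (p w) < f w"
    and "\<And>w x. w \<in> pverts G \<Longrightarrow> 0 < f w \<Longrightarrow> (p w, x) \<in> parcs G \<Longrightarrow> x \<noteq> w \<Longrightarrow> f x < f w"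
  shows "forcing_schedule G t f p"
  using assms unfolding forcing_schedule_def by blast

lemma forcing_scheduleD:
  assumes "forcing_schedule G t f p" "w \<in> pverts G"
  shows "f w \<le> t"
    and "0 < f w \<Longrightarrow> (p w, w) \<in> parcs G"
    and "0 < f w \<Longrightarrow> f (p w) < f w"
    and "0 < f w \<Longrightarrow> (p w, x) \<in> parcs G \<Longrightarrow> x \<noteq> w \<Longrightarrow> f x < f w"
  using assms unfolding forcing_schedule_def by blast+

section \<open>Schedules compared with actual propagation\<close>

text \<open>The blue set \<open>S\<close> may run ahead of the schedule: it suffices that all
  vertices due before \<open>w\<close> are blue, as \<open>p w\<close> and its other out-neighbors
  are among them.\<close>

lemma forcing_schedule_can_force:
  assumes G: "pair_digraph G" and sched: "forcing_schedule G t f p"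
    and w: "w \<in> pverts G" "0 < f w" "w \<notin> S"
    and S: "\<And>x. x \<in> pverts G \<Longrightarrow> f x < f w \<Longrightarrow> x \<in> S"
  shows "can_force G S (p w) w"
proof -
  interpret pair_digraph G by fact
  note D = forcing_scheduleD[OF sched w(1)]
  have "p w \<in> S"
    using S D(2,3) w(2) by (blast dest: in_arcsD1)
  moreover have "x \<in> S" if "(p w, x) \<in> parcs G" "x \<noteq> w" for x
    using that S D(4) w(2) by (blast dest: in_arcsD2)
  ultimately show ?thesis
    using D(2) w(2,3) unfolding can_force_def out_neighbors_def by blast
qed

text \<open>Performing the forces in order of nondecreasing time makes each valid at its turn. This
  yields the sequential order required by \<open>is_set_of_forces\<close>.\<close>

lemma forcing_run_of_schedule:
  assumes G: "pair_digraph G" and sched: "forcing_schedule G t f p"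
    and "{v \<in> pverts G. f v = 0} \<subseteq> S" "S \<subseteq> pverts G"
  shows "\<exists>fs. set fs = (\<lambda>w. (p w, w)) ` (pverts G - S) \<and> forcing_run G S fs (pverts G)"
  using assms(3,4)
proof (induction "card (pverts G - S)" arbitrary: S rule: less_induct)
  case less
  interpret pair_digraph G by fact
  show ?case
  proof (cases "S = pverts G")
    case True
    then show ?thesis using forcing_run_Nil by (intro exI[of _ "[]"]) auto
  next
    case False
    \<comment> \<open>For a white vertex of least time, everything due strictly earlier is blue, so
      it can be forced next.\<close>
    then obtain w where w: "w \<in> pverts G - S" and min: "\<And>x. x \<in> pverts G - S \<Longrightarrow> f w \<le> f x"
      using less.prems ex_has_least_nat[of "\<lambda>x. x \<in> pverts G - S" _ f] by blast
    have force: "can_force G S (p w) w"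
    proof (rule forcing_schedule_can_force[OF G sched])
      show "0 < f w" using w less.prems(1) by auto
      show "x \<in> S" if "x \<in> pverts G" "f x < f w" for x
        using that min[of x] by (meson Diff_iff not_less)
    qed (use w in auto)
    have "card (pverts G - insert w S) < card (pverts G - S)"
      using w by (intro psubset_card_mono) auto
    then obtain fs where "set fs = (\<lambda>w. (p w, w)) ` (pverts G - insert w S)"
      "forcing_run G (insert w S) fs (pverts G)"
      using less.hyps[of "insert w S"] less.prems w by blast
    then show ?thesis
      using w by (intro exI[of _ "(p w, w) # fs"]) (auto intro: forcing_run_Cons[OF force])
  qed
qed

lemma blue_at_subset:
  assumes "pair_digraph G" "B \<subseteq> pverts G"
  shows "blue_at G B F t \<subseteq> pverts G"
proof -
  interpret pair_digraph G by fact
  show ?thesis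
    using assms(2) by (induction t) (auto simp: can_force_def out_neighbors_def dest: in_arcsD2)
qed

text \<open>Only an inclusion: propagation performs each force of \<open>F\<close> as soon as it is
  valid, hence may overtake the schedule.\<close>

lemma blue_at_of_schedule:
  assumes G: "pair_digraph G" and sched: "forcing_schedule G t f p"
    and B: "B = {v \<in> pverts G. f v = 0}"
    and F: "F = (\<lambda>w. (p w, w)) ` (pverts G - B)"
  shows "{v \<in> pverts G. f v \<le> s} \<subseteq> blue_at G B F s"
proof (induction s)
  case 0
  then show ?case using B by auto
next
  case (Suc s)
  show ?case
  proof
    fix w assume w: "w \<in> {v \<in> pverts G. f v \<le> Suc s}"
    show "w \<in> blue_at G B F (Suc s)"
    proof (cases "w \<in> blue_at G B F s")
      case False
      then have "f w = Suc s" using w Suc.IH by force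
      then have "can_force G (blue_at G B F s) (p w) w"
        using w Suc.IH False by (intro forcing_schedule_can_force[OF G sched]) auto
      moreover have "(p w, w) \<in> F" using w \<open>f w = Suc s\<close> B F by auto
      ultimately show ?thesis using False by auto
    qed simp
  qed
qed

lemma throttling_number_le_of_schedulable:
  assumes G: "pair_digraph G" and "schedulable G k t"
  shows "throttling_number G \<le> enat (k + t)"
proof -
  interpret pair_digraph G by fact
  obtain f p where sched: "forcing_schedule G t f p" and k: "card {v \<in> pverts G. f v = 0} = k"
    using assms(2) unfolding schedulable_def by blast
  define B where "B = {v \<in> pverts G. f v = 0}"
  define F where "F = (\<lambda>w. (p w, w)) ` (pverts G - B)"
  have B: "B \<subseteq> pverts G" unfolding B_def by auto
  have "\<nexists>u w. can_force G (pverts G) u w"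
    by (auto simp: can_force_def out_neighbors_def dest: in_arcsD2)
  then have forces: "is_set_of_forces G B F"
    using forcing_run_of_schedule[OF G sched, of B] B
    unfolding is_set_of_forces_def F_def B_def by blast
  have "{v \<in> pverts G. f v \<le> t} = pverts G"
    using forcing_scheduleD(1)[OF sched] by auto
  then have "blue_at G B F t = pverts G"
    using blue_at_of_schedule[OF G sched B_def F_def, of t] blue_at_subset[OF G B] by blast
  then have "prop_time_forces G B F \<le> enat t"
    unfolding prop_time_forces_def by (auto intro: Least_le)
  then have "prop_time G B \<le> enat t"
    unfolding prop_time_def using forces by (intro INF_lower2[of F]) auto
  then have "enat (card B) + prop_time G B \<le> enat (k + t)"
    using k add_left_mono[of "prop_time G B" "enat t" "enat (card B)"] unfolding B_def by simp
  then show ?thesis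
    unfolding throttling_number_def using B by (intro INF_lower2[of B]) auto
qed

text \<open>The first blue times form a schedule: when \<open>w\<close> is forced, its forcer and
  the other out-neighbors of the forcer are already blue, hence have smaller times.\<close>

lemma schedulable_of_blue_at:
  assumes all: "blue_at G B F t = pverts G" and B: "B \<subseteq> pverts G"
  shows "schedulable G (card B) t"
proof -
  define f where "f v = (LEAST s. v \<in> blue_at G B F s)" for v
  \<comment> \<open>Several vertices may be able to force \<open>w\<close> just before it turns
    blue; one is chosen. For initially blue \<open>w\<close> the value is irrelevant.\<close>
  define p where "p w = (SOME u. can_force G (blue_at G B F (f w - 1)) u w)" for w
  have blue_f: "w \<in> blue_at G B F (f w)" if "w \<in> pverts G" for w
    using that all LeastI[of "\<lambda>s. w \<in> blue_at G B F s" t] unfolding f_def by simp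
  have f_le: "f w \<le> s" if "w \<in> blue_at G B F s" for w s
    using that unfolding f_def by (rule Least_le)
  have force: "can_force G (blue_at G B F (f w - 1)) (p w) w" if w: "w \<in> pverts G" "0 < f w" for w
  proof -
    obtain s where s: "f w = Suc s" using w(2) gr0_implies_Suc by blast
    then have "w \<notin> blue_at G B F s" using f_le by fastforce
    then have "\<exists>u. can_force G (blue_at G B F (f w - 1)) u w"
      using blue_f[OF w(1)] s by auto
    then show ?thesis unfolding p_def by (rule someI_ex)
  qed
  have "forcing_schedule G t f p"
  proof (rule forcing_scheduleI)
    fix w assume w: "w \<in> pverts G"
    then show "f w \<le> t" using all f_le by blast
    assume pos: "0 < f w"
    note force = force[OF w pos]
    then show "(p w, w) \<in> parcs G"
      unfolding can_force_def out_neighbors_def by blast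
    show "f (p w) < f w"
      using force f_le[of "p w" "f w - 1"] pos unfolding can_force_def by linarith
    show "f x < f w" if "(p w, x) \<in> parcs G" "x \<noteq> w" for x
    proof -
      have "x \<in> blue_at G B F (f w - 1)"
        using force that unfolding can_force_def out_neighbors_def by blast
      then show ?thesis using f_le[of x "f w - 1"] pos by linarith
    qed
  qed
  moreover have "{v \<in> pverts G. f v = 0} = B"
    using B blue_f f_le[of _ 0] by fastforce
  ultimately show ?thesis unfolding schedulable_def by blast
qed

text \<open>Reduces the theorem to comparing which pairs \<open>(k, t)\<close> are
  schedulable.\<close>

lemma throttling_number_eq_INF_schedulable:
  assumes G: "pair_digraph G"
  shows "throttling_number G = (INF (k, t)\<in>{(k, t). schedulable G k t}. enat (k + t))"
    (is "_ = ?I")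
proof (rule antisym)
  show "throttling_number G \<le> ?I"
    using throttling_number_le_of_schedulable[OF G] by (intro INF_greatest) auto
  show "?I \<le> throttling_number G"
    unfolding throttling_number_def
  proof (rule INF_greatest)
    fix B assume "B \<in> Pow (pverts G)"
    then have B: "B \<subseteq> pverts G" by simp
    \<comment> \<open>The infimum over a nonempty set of \<open>enat\<close> values is
      attained.\<close>
    have "prop_time G B \<in> prop_time_forces G B ` {F. is_set_of_forces G B F}"
      unfolding prop_time_def using ex_set_of_forces[OF G B]
      by (metis (mono_tags) mem_Collect_eq imageI wellorder_InfI)
    then obtain F where F: "prop_time G B = prop_time_forces G B F" by blast
    show "?I \<le> enat (card B) + prop_time G B"
    proof (cases "\<exists>t. blue_at G B F t = pverts G")
      case True
      define t where "t = (LEAST t. blue_at G B F t = pverts G)"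
      have "blue_at G B F t = pverts G" unfolding t_def using True by (rule LeastI_ex)
      then have "schedulable G (card B) t" using B by (rule schedulable_of_blue_at)
      moreover have "prop_time G B = enat t"
        using F True unfolding prop_time_forces_def t_def by simp
      ultimately show ?thesis by (intro INF_lower2[of "(card B, t)"]) auto
    next
      case False
      then show ?thesis using F unfolding prop_time_forces_def by simp
    qed
  qed
qed

section \<open>Reversal of processes\<close>

lemma schedulable_transpose:
  assumes G: "pair_digraph G" and "schedulable G k t"
  shows "schedulable (transpose_digraph G) k t"
proof -
  interpret pair_digraph G by fact
  obtain f p where sched: "forcing_schedule G t f p" and k: "card {v \<in> pverts G. f v = 0} = k"
    using assms(2) unfolding schedulable_def by blast
  define W where "W = {w \<in> pverts G. 0 < f w}"
  define q where "q = inv_into W p"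
  \<comment> \<open>Since \<open>1 \<le> f w \<le> t\<close> on \<open>W\<close>, forcing vertices
    get times from 1 to \<open>t\<close>. The default 0 makes the vertices that force nothing
    initially blue.\<close>
  define g where "g v = (if v \<in> p ` W then t + 1 - f (q v) else 0)" for v
  have W: "w \<in> pverts G" "0 < f w" "f w \<le> t" "(p w, w) \<in> parcs G" "f (p w) < f w"
    if "w \<in> W" for w
    using that forcing_scheduleD[OF sched] unfolding W_def by auto
  have out: "f x < f w" if "w \<in> W" "(p w, x) \<in> parcs G" "x \<noteq> w" for w x
    using that forcing_scheduleD(4)[OF sched] unfolding W_def by auto
  \<comment> \<open>If one vertex forced both \<open>w\<close> and \<open>x\<close>, each would have
    to turn blue before the other.\<close>
  have inj: "inj_on p W"
  proof (rule inj_onI, rule ccontr)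
    fix w x assume "w \<in> W" "x \<in> W" "p w = p x" "w \<noteq> x"
    then have "f x < f w" "f w < f x" using out[of w x] out[of x w] W(4) by metis+
    then show False by simp
  qed
  have g_p: "g (p w) = t + 1 - f w" if "w \<in> W" for w
    using that inv_into_f_f[OF inj that] unfolding g_def q_def by simp
  have g_pos: "\<exists>w\<in>W. v = p w \<and> q v = w" if "0 < g v" for v
    using that inv_into_f_f[OF inj] unfolding g_def q_def by (auto split: if_splits)
  have "forcing_schedule (transpose_digraph G) t g q"
  proof (rule forcing_scheduleI)
    fix v
    show "g v \<le> t"
      using g_pos[of v] g_p W(2) by (cases "0 < g v") fastforce+
    assume "0 < g v"
    then obtain w where w: "w \<in> W" "v = p w" "q v = w" using g_pos by blast
    show "(q v, v) \<in> parcs (transpose_digraph G)"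
      using w W(4) unfolding transpose_digraph_def by simp
    \<comment> \<open>Common criterion for both remaining conditions: either \<open>x\<close> is
      initially blue in the reversed process, or its original force came after that of
      \<open>v\<close>.\<close>
    have less: "g x < g v" if "0 < g x \<Longrightarrow> \<exists>y\<in>W. x = p y \<and> f w < f y" for x
      using that w \<open>0 < g v\<close> g_p W(3) by (cases "0 < g x") fastforce+
    \<comment> \<open>If \<open>w = q v\<close> itself forces some \<open>y\<close>, it does so
      after turning blue, so \<open>f w < f y\<close>.\<close>
    show "g (q v) < g v"
      using w W(5) g_pos by (intro less) metis
    show "g x < g v" if "(q v, x) \<in> parcs (transpose_digraph G)" "x \<noteq> v" for x
    proof (rule less)
      assume "0 < g x"
      then obtain y where y: "y \<in> W" "x = p y" using g_pos by blast
      \<comment> \<open>Thus \<open>w\<close> is an out-neighbor of \<open>p y\<close> other than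
        \<open>y\<close> and must be blue before \<open>y\<close> is forced.\<close>
      then have "(p y, w) \<in> parcs G" "w \<noteq> y"
        using that w unfolding transpose_digraph_def by auto
      then show "\<exists>y\<in>W. x = p y \<and> f w < f y" using out y by blast
    qed
  qed
  moreover have "card {v \<in> pverts (transpose_digraph G). g v = 0} = k"
  proof -
    have "g v = 0 \<longleftrightarrow> v \<notin> p ` W" for v
      using g_p W(3) unfolding g_def by fastforce
    then have "{v \<in> pverts (transpose_digraph G). g v = 0} = pverts G - p ` W"
      unfolding transpose_digraph_def by auto
    also have "card \<dots> = card (pverts G) - card (p ` W)"
      using W(4) by (intro card_Diff_subset) (auto simp: W_def dest: in_arcsD1)
    also have "\<dots> = card (pverts G) - card W"
      using inj by (simp add: card_image)
    also have "\<dots> = card (pverts G - W)"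
      by (intro card_Diff_subset[symmetric]) (auto simp: W_def)
    also have "pverts G - W = {v \<in> pverts G. f v = 0}" unfolding W_def by auto
    finally show ?thesis using k by simp
  qed
  ultimately show ?thesis unfolding schedulable_def by blast
qed

lemma transpose_digraph_involution [simp]: "transpose_digraph (transpose_digraph G) = G"
  unfolding transpose_digraph_def by simp

lemma schedulable_transpose_iff:
  assumes "pair_digraph G"
  shows "schedulable (transpose_digraph G) k t \<longleftrightarrow> schedulable G k t"
  using schedulable_transpose[OF assms]
    schedulable_transpose[OF pair_digraph_transpose[OF assms]] by auto

section \<open>Disjoint unions\<close>

lemma pverts_disjoint_union: "pverts (disjoint_union G H) = pverts G <+> pverts H"
  unfolding disjoint_union_def by simp

lemma in_parcs_disjoint_union:
  "(Inl a, v) \<in> parcs (disjoint_union G H) \<longleftrightarrow> (\<exists>b. v = Inl b \<and> (a, b) \<in> parcs G)"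
  "(v, Inl b) \<in> parcs (disjoint_union G H) \<longleftrightarrow> (\<exists>a. v = Inl a \<and> (a, b) \<in> parcs G)"
  "(Inr c, v) \<in> parcs (disjoint_union G H) \<longleftrightarrow> (\<exists>d. v = Inr d \<and> (c, d) \<in> parcs H)"
  "(v, Inr d) \<in> parcs (disjoint_union G H) \<longleftrightarrow> (\<exists>c. v = Inr c \<and> (c, d) \<in> parcs H)"
  unfolding disjoint_union_def by force+

lemma card_zeros_disjoint_union:
  assumes "pair_digraph G" "pair_digraph H"
  shows "card {v \<in> pverts (disjoint_union G H). f v = (0 :: nat)} =
    card {a \<in> pverts G. f (Inl a) = 0} + card {c \<in> pverts H. f (Inr c) = 0}"
proof -
  interpret G: pair_digraph G by fact
  interpret H: pair_digraph H by fact
  have "{v \<in> pverts (disjoint_union G H). f v = 0} =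
    {a \<in> pverts G. f (Inl a) = 0} <+> {c \<in> pverts H. f (Inr c) = 0}"
    unfolding pverts_disjoint_union by auto
  then show ?thesis by (simp add: card_Plus)
qed

text \<open>No arc joins the two parts, so forcers and their out-neighbors stay within one part and
  the conditions decouple.\<close>

lemma schedulable_disjoint_union_iff:
  assumes G: "pair_digraph G" and H: "pair_digraph H"
  shows "schedulable (disjoint_union G H) k t \<longleftrightarrow>
    (\<exists>i j. schedulable G i t \<and> schedulable H j t \<and> k = i + j)"
proof
  assume "schedulable (disjoint_union G H) k t"
  then obtain f p where sched: "forcing_schedule (disjoint_union G H) t f p"
    and k: "card {v \<in> pverts (disjoint_union G H). f v = 0} = k"
    unfolding schedulable_def by blast
  \<comment> \<open>\<open>projl\<close> is meaningful where it matters: a vertex with positive time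
    has its forcer in the same part.\<close>
  have "forcing_schedule G t (\<lambda>a. f (Inl a)) (\<lambda>a. projl (p (Inl a)))"
  proof (rule forcing_scheduleI)
    fix a assume "a \<in> pverts G"
    then have "Inl a \<in> pverts (disjoint_union G H)" by (auto simp: pverts_disjoint_union)
    note D = forcing_scheduleD[OF sched this]
    show "f (Inl a) \<le> t" by (rule D(1))
    assume pos: "0 < f (Inl a)"
    then obtain b where b: "p (Inl a) = Inl b" "(b, a) \<in> parcs G"
      using D(2) in_parcs_disjoint_union(2) by metis
    show "(projl (p (Inl a)), a) \<in> parcs G" using b by simp
    show "f (Inl (projl (p (Inl a)))) < f (Inl a)" using b D(3) pos by simp
    show "f (Inl x) < f (Inl a)" if "(projl (p (Inl a)), x) \<in> parcs G" "x \<noteq> a" for x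
      using that b by (intro D(4) pos) (auto simp: in_parcs_disjoint_union)
  qed
  moreover have "forcing_schedule H t (\<lambda>c. f (Inr c)) (\<lambda>c. projr (p (Inr c)))"
  proof (rule forcing_scheduleI)
    fix a assume "a \<in> pverts H"
    then have "Inr a \<in> pverts (disjoint_union G H)" by (auto simp: pverts_disjoint_union)
    note D = forcing_scheduleD[OF sched this]
    show "f (Inr a) \<le> t" by (rule D(1))
    assume pos: "0 < f (Inr a)"
    then obtain b where b: "p (Inr a) = Inr b" "(b, a) \<in> parcs H"
      using D(2) in_parcs_disjoint_union(4) by metis
    show "(projr (p (Inr a)), a) \<in> parcs H" using b by simp
    show "f (Inr (projr (p (Inr a)))) < f (Inr a)" using b D(3) pos by simp
    show "f (Inr x) < f (Inr a)" if "(projr (p (Inr a)), x) \<in> parcs H" "x \<noteq> a" for x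
      using that b by (intro D(4) pos) (auto simp: in_parcs_disjoint_union)
  qed
  ultimately show "\<exists>i j. schedulable G i t \<and> schedulable H j t \<and> k = i + j"
    unfolding schedulable_def k[symmetric] card_zeros_disjoint_union[OF G H] by blast
next
  assume "\<exists>i j. schedulable G i t \<and> schedulable H j t \<and> k = i + j"
  then obtain f1 p1 f2 p2 where scheds: "forcing_schedule G t f1 p1" "forcing_schedule H t f2 p2"
    and k: "k = card {a \<in> pverts G. f1 a = 0} + card {c \<in> pverts H. f2 c = 0}"
    unfolding schedulable_def by blast
  have "forcing_schedule (disjoint_union G H) t (case_sum f1 f2) (map_sum p1 p2)"
    using scheds unfolding forcing_schedule_def
    by (auto simp: pverts_disjoint_union in_parcs_disjoint_union) blast+
  moreover have "card {v \<in> pverts (disjoint_union G H). case_sum f1 f2 v = 0} = k"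
    using k card_zeros_disjoint_union[OF G H, of "case_sum f1 f2"] by simp
  ultimately show "schedulable (disjoint_union G H) k t" unfolding schedulable_def by blast
qed

text \<open>Both sides are infima over the same pairs: \<open>k\<close> splits as
  \<open>i + j\<close> at a common \<open>t\<close>, and transposing \<open>G1\<close> preserves its
  pairs \<open>(i, t)\<close>.\<close>

theorem theorem2p15:
  fixes G1 :: "'a pair_pre_digraph" and G2 :: "'b pair_pre_digraph"
  assumes "pair_digraph G1" and "pair_digraph G2"
  shows "throttling_number (disjoint_union G1 G2)
    = throttling_number (disjoint_union (transpose_digraph G1) G2)"
  using assms pair_digraph_transpose[OF assms(1)]
  by (simp add: throttling_number_eq_INF_schedulable pair_digraph_disjoint_union
      schedulable_disjoint_union_iff schedulable_transpose_iff)

end
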